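(* There exist constants $\varepsilon_0>0$ and $C>0$ such that for every $\varepsilon\in[0,\varepsilon_0]$ and every domain $A\subset\mathbb{R}^2$ whose boundary is a rectifiable curve and which satisfies $$|\partial A|^2\leqslant (16+\varepsilon)\,|A|,$$ there is a square $S$ such that $|S|=|A|$ and $$|S\cap A| \geqslant \Big(1-\frac{\sqrt{\varepsilon}}{4}-C\varepsilon\Big)|A|,$$ or, in terms of Fraenkel asymmetry (with $S\Delta A$ the symmetric difference), $$\frac{|S\Delta A|}{|A|} \leqslant \frac{\sqrt{\varepsilon}}{2}+2C\varepsilon .$$
   Context: The plane $\mathbb{R}^2$ is endowed with the $L^1$ metric $|(x_1,x_2)-(y_1,y_2)|=|x_1-y_1|+|x_2-y_2|$. A *domain* is the closure of the bounded connected component of the complement of a Jordan curve in $\mathbb{R}^2$; $\partial A$ denotes the boundary of $A$. For a measurable set $A$, $|A|$ is its Lebesgue measure; for a rectifiable curve $\gamma$, $|\gamma|$ is its length with respect to the $L^1$ metric; in particular $|\partial A|$ is the $L^1$ length of the Jordan curve $\partial A$. All squares (taken as full closed squares) have their sides parallel to the coordinate axes. *)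

theory Defs
  imports "HOL-Analysis.Analysis"
begin

(* The plane is the type real \<times> real.  Its library metric is Euclidean; this gives the same
   topology and the same rectifiable curves as the L1 metric, but not the same lengths. *)

definition l1_dist :: "real \<times> real \<Rightarrow> real \<times> real \<Rightarrow> real" where
  "l1_dist x y = \<bar>fst x - fst y\<bar> + \<bar>snd x - snd y\<bar>"

definition inscribed_lengths :: "(real \<Rightarrow> real \<times> real) \<Rightarrow> real set" where
  "inscribed_lengths \<gamma> =
     {(\<Sum>i<n. l1_dist (\<gamma> (t i)) (\<gamma> (t (Suc i)))) | (n::nat) (t::nat \<Rightarrow> real).
        t 0 = 0 \<and> t n = 1 \<and> (\<forall>i<n. t i \<le> t (Suc i))}"

definition rectifiable :: "(real \<Rightarrow> real \<times> real) \<Rightarrow> bool" where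
  "rectifiable \<gamma> \<longleftrightarrow> path \<gamma> \<and> bdd_above (inscribed_lengths \<gamma>)"

(* Only meaningful for rectifiable curves: Sup of an unbounded set of reals is unspecified. *)
definition l1_length :: "(real \<Rightarrow> real \<times> real) \<Rightarrow> real" where
  "l1_length \<gamma> = Sup (inscribed_lengths \<gamma>)"

definition jordan_curve :: "(real \<Rightarrow> real \<times> real) \<Rightarrow> bool" where
  "jordan_curve \<gamma> \<longleftrightarrow> simple_path \<gamma> \<and> pathfinish \<gamma> = pathstart \<gamma>"

definition jordan_domain :: "(real \<times> real) set \<Rightarrow> bool" where
  "jordan_domain A \<longleftrightarrow>
     (\<exists>\<gamma> U. jordan_curve \<gamma> \<and> U \<in> components (- path_image \<gamma>) \<and> bounded U \<and> A = closure U)"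

definition axis_square :: "(real \<times> real) set \<Rightarrow> bool" where
  "axis_square S \<longleftrightarrow> (\<exists>a b s. s > 0 \<and> S = {a..a + s} \<times> {b..b + s})"

end

theory Submission
  imports Defs
begin

text \<open>
  The perimeter in the \<open>L\<^sup>1\<close> metric cannot see more than the bounding box. Let the box of \<open>A\<close> have
  sides \<open>w\<close> and \<open>h\<close>. The boundary curve visits all four sides of the box and closes up, so each
  coordinate must sweep its range twice and the length is at least \<open>2 * (w + h)\<close>; on the other hand
  the area \<open>s\<^sup>2\<close> of \<open>A\<close> is at most \<open>w * h\<close>. The hypothesis thus becomes
  \<open>4 * (w + h)\<^sup>2 \<le> (16 + \<epsilon>) * s\<^sup>2\<close> with \<open>s\<^sup>2 \<le> w * h\<close>, which is near-equality in the inequality of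
  arithmetic and geometric means: \<open>w + h\<close> exceeds \<open>2 * s\<close> only to order \<open>\<epsilon>\<close>, while
  \<open>(w - h)\<^sup>2 = (w + h)\<^sup>2 - 4 * w * h\<close> is at most \<open>\<epsilon> * s\<^sup>2 / 4\<close>, so that no side is longer than
  \<open>(1 + sqrt \<epsilon> / 4 + \<epsilon> / 32) * s\<close>.

  The square \<open>S\<close> of side \<open>s\<close> is put into the lower left corner of the box. The part of \<open>A\<close> outside
  \<open>S\<close> lies in the part of the box outside \<open>S\<close>, and the latter has area at most
  \<open>(sqrt \<epsilon> / 4 + \<epsilon> / 16) * s\<^sup>2\<close> (\<open>box_minus_corner_square_area\<close>): either the square fits into the
  box and only the excess area \<open>w * h - s\<^sup>2\<close> is lost, or it sticks out in the short direction and
  a strip is lost, whose width is the excess of the long side. Since \<open>S\<close> and \<open>A\<close> have equal area,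
  the symmetric difference has twice the area of \<open>A - S\<close>. The argument gives \<open>C = 1 / 16\<close>.
\<close>

section \<open>Length of a closed curve and width of its image\<close>

lemma dist_le_variation:
  fixes f :: "nat \<Rightarrow> real"
  assumes "i \<le> j"
  shows "\<bar>f i - f j\<bar> \<le> (\<Sum>k=i..<j. \<bar>f k - f (Suc k)\<bar>)"
  using assms
proof (induction rule: dec_induct)
  case (step k)
  then show ?case by simp
qed simp

text \<open>The two values split the closed cycle into two arcs, and each arc has variation at least the
  distance between the values.\<close>
lemma closed_variation_ge:
  fixes f :: "nat \<Rightarrow> real"
  assumes "f 0 = f n" "i \<le> n" "j \<le> n"
  shows "2 * (f i - f j) \<le> (\<Sum>k<n. \<bar>f k - f (Suc k)\<bar>)"
proof -
  have *: "2 * \<bar>f i - f j\<bar> \<le> (\<Sum>k<n. \<bar>f k - f (Suc k)\<bar>)" if "i \<le> j" "j \<le> n" for i j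
  proof -
    let ?g = "\<lambda>k. \<bar>f k - f (Suc k)\<bar>"
    have "sum ?g {0..<i} + sum ?g {i..<j} + sum ?g {j..<n} = sum ?g {0..<n}"
      using that by (simp add: sum.atLeastLessThan_concat)
    moreover have "\<bar>f 0 - f i\<bar> \<le> sum ?g {0..<i}" "\<bar>f i - f j\<bar> \<le> sum ?g {i..<j}"
        "\<bar>f j - f n\<bar> \<le> sum ?g {j..<n}"
      using that by (simp_all add: dist_le_variation)
    moreover have "\<bar>f i - f j\<bar> \<le> \<bar>f 0 - f i\<bar> + \<bar>f j - f n\<bar>"
      using assms(1) by linarith
    ultimately have "2 * \<bar>f i - f j\<bar> \<le> sum ?g {0..<n}"
      by (smt (verit))
    then show ?thesis
      by (simp add: atLeast0LessThan)
  qed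
  have "2 * \<bar>f i - f j\<bar> \<le> (\<Sum>k<n. \<bar>f k - f (Suc k)\<bar>)"
    using *[of i j] *[of j i] assms(2,3) by (metis abs_minus_commute nle_le)
  then show ?thesis
    by (smt (verit))
qed

lemma partition_through_finite_set:
  fixes T :: "real set"
  assumes "finite T" "T \<subseteq> {0..1}"
  obtains n :: nat and t :: "nat \<Rightarrow> real"
  where "t 0 = 0" "t n = 1" "\<And>i. i < n \<Longrightarrow> t i \<le> t (Suc i)" "T \<subseteq> t ` {..n}"
proof -
  define xs where "xs = sorted_list_of_set (insert 0 (insert 1 T))"
  have set: "set xs = insert 0 (insert 1 T)" and sorted: "sorted xs"
    using assms(1) by (simp_all add: xs_def del: sorted_list_of_set_insert_remove)
  define n where "n = length xs - 1"
  have len: "length xs = Suc n"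
    using set by (cases xs) (auto simp: n_def)
  have range: "xs ! i \<in> {0..1}" if "i \<le> n" for i
    using nth_mem[of i xs] that len set assms(2) by auto
  obtain k where k: "k \<le> n" "xs ! k = 0"
    using set len by (metis in_set_conv_nth insertI1 less_Suc_eq_le)
  obtain l where l: "l \<le> n" "xs ! l = 1"
    using set len by (metis in_set_conv_nth insertI1 insertI2 less_Suc_eq_le)
  show thesis
  proof
    show "xs ! 0 = 0"
      using sorted_nth_mono[OF sorted, of 0 k] k len range[of 0] by auto
    show "xs ! n = 1"
      using sorted_nth_mono[OF sorted, of l n] l len range[of n] by auto
    show "xs ! i \<le> xs ! Suc i" if "i < n" for i
      using sorted_nth_mono[OF sorted, of i "Suc i"] that len by auto
    show "T \<subseteq> (\<lambda>i. xs ! i) ` {..n}"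
    proof -
      have "set xs = (\<lambda>i. xs ! i) ` {..n}"
        by (auto simp: set_conv_nth len less_Suc_eq_le)
      then show ?thesis
        using set by blast
    qed
  qed
qed

text \<open>The \<open>L\<^sup>1\<close> length of an inscribed polygon is the sum of the variations of its two coordinates.
  A polygon through all four points bounds both variations at once.\<close>
lemma closed_curve_length_ge:
  assumes "rectifiable \<gamma>" "pathfinish \<gamma> = pathstart \<gamma>"
    and "{p, q, p', q'} \<subseteq> path_image \<gamma>"
  shows "2 * ((fst p - fst q) + (snd p' - snd q')) \<le> l1_length \<gamma>"
proof -
  obtain T where T: "T \<subseteq> {0..1}" "finite T" "{p, q, p', q'} = \<gamma> ` T"
    using finite_subset_image[OF _ assms(3)[unfolded path_image_def]] by blast
  obtain n t where t: "t 0 = 0" "t n = 1" "\<And>i. i < n \<Longrightarrow> t i \<le> t (Suc i)" "T \<subseteq> t ` {..n}"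
    using partition_through_finite_set[OF T(2,1)] by metis
  have vertex: "\<exists>i\<le>n. x = \<gamma> (t i)" if "x \<in> {p, q, p', q'}" for x
    using that t(4) unfolding T(3) by blast
  obtain i j i' j' where ij: "i \<le> n" "j \<le> n" "i' \<le> n" "j' \<le> n"
      "p = \<gamma> (t i)" "q = \<gamma> (t j)" "p' = \<gamma> (t i')" "q' = \<gamma> (t j')"
    using vertex[of p] vertex[of q] vertex[of p'] vertex[of q'] by auto
  have closed: "\<gamma> (t 0) = \<gamma> (t n)"
    using assms(2) t by (simp add: pathstart_def pathfinish_def)
  let ?L = "\<Sum>k<n. l1_dist (\<gamma> (t k)) (\<gamma> (t (Suc k)))"
  have "2 * (fst p - fst q) + 2 * (snd p' - snd q') \<le> ?L"
    unfolding l1_dist_def sum.distrib ij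
    using ij closed by (intro add_mono closed_variation_ge) auto
  also have "?L \<le> l1_length \<gamma>"
    unfolding l1_length_def
  proof (rule cSup_upper)
    show "?L \<in> inscribed_lengths \<gamma>"
      unfolding inscribed_lengths_def using t by blast
    show "bdd_above (inscribed_lengths \<gamma>)"
      using assms(1) by (simp add: rectifiable_def)
  qed
  finally show ?thesis by simp
qed

section \<open>The bounding box\<close>

text \<open>A maximum of a nonzero linear functional cannot be interior: one could move a little in the
  direction of the functional.\<close>
lemma frontier_attains_max_inner:
  fixes A :: "'a::real_inner set"
  assumes "compact A" "A \<noteq> {}" "v \<noteq> 0"
  obtains x where "x \<in> frontier A" "\<And>y. y \<in> A \<Longrightarrow> y \<bullet> v \<le> x \<bullet> v"
proof -
  have "continuous_on A (\<lambda>y. y \<bullet> v)"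
    by (intro continuous_intros)
  then obtain x where x: "x \<in> A" "\<And>y. y \<in> A \<Longrightarrow> y \<bullet> v \<le> x \<bullet> v"
    using continuous_attains_sup[OF assms(1,2)] by blast
  have "x \<notin> interior A"
  proof
    assume "x \<in> interior A"
    then obtain e where e: "e > 0" "cball x e \<subseteq> A"
      by (auto simp: mem_interior_cball)
    have "x + (e / norm v) *\<^sub>R v \<in> A"
      using e assms(3) by (intro subsetD[OF e(2)]) (simp add: dist_norm)
    then have "(x + (e / norm v) *\<^sub>R v) \<bullet> v \<le> x \<bullet> v"
      by (rule x(2))
    moreover have "0 < (e / norm v) * (v \<bullet> v)"
      using e assms(3) by simp
    ultimately show False
      by (simp add: inner_add_left)
  qed
  then have "x \<in> frontier A"
    using x(1) closure_subset by (auto simp: frontier_def)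
  then show thesis
    using x(2) that by blast
qed

lemma bounding_box_perimeter_le:
  assumes "compact A" "A \<noteq> {}" "path_image \<gamma> = frontier A"
    and "rectifiable \<gamma>" "pathfinish \<gamma> = pathstart \<gamma>"
  obtains a b w h where "w \<ge> 0" "h \<ge> 0" "A \<subseteq> {a..a + w} \<times> {b..b + h}"
    "2 * (w + h) \<le> l1_length \<gamma>"
proof -
  obtain p where p: "p \<in> frontier A" "\<And>y. y \<in> A \<Longrightarrow> fst y \<le> fst p"
    using frontier_attains_max_inner[OF assms(1,2), of "(1, 0)"] by (auto simp: inner_prod_def zero_prod_def)
  obtain q where q: "q \<in> frontier A" "\<And>y. y \<in> A \<Longrightarrow> fst q \<le> fst y"
    using frontier_attains_max_inner[OF assms(1,2), of "(-1, 0)"] by (auto simp: inner_prod_def zero_prod_def)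
  obtain p' where p': "p' \<in> frontier A" "\<And>y. y \<in> A \<Longrightarrow> snd y \<le> snd p'"
    using frontier_attains_max_inner[OF assms(1,2), of "(0, 1)"] by (auto simp: inner_prod_def zero_prod_def)
  obtain q' where q': "q' \<in> frontier A" "\<And>y. y \<in> A \<Longrightarrow> snd q' \<le> snd y"
    using frontier_attains_max_inner[OF assms(1,2), of "(0, -1)"] by (auto simp: inner_prod_def zero_prod_def)
  obtain z where "z \<in> A"
    using assms(2) by blast
  show thesis
  proof
    show "0 \<le> fst p - fst q" "0 \<le> snd p' - snd q'"
      using p(2)[OF \<open>z \<in> A\<close>] q(2)[OF \<open>z \<in> A\<close>] p'(2)[OF \<open>z \<in> A\<close>] q'(2)[OF \<open>z \<in> A\<close>]
      by linarith+
    show "A \<subseteq> {fst q..fst q + (fst p - fst q)} \<times> {snd q'..snd q' + (snd p' - snd q')}"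
      using p(2) q(2) p'(2) q'(2) by (auto simp: mem_Times_iff)
    show "2 * ((fst p - fst q) + (snd p' - snd q')) \<le> l1_length \<gamma>"
      using closed_curve_length_ge[OF assms(4,5)] p(1) q(1) p'(1) q'(1) assms(3) by simp
  qed
qed

section \<open>Areas\<close>

lemma rectangle_eq_cbox:
  fixes a b c d :: real
  shows "{a..b} \<times> {c..d} = cbox (a, c) (b, d)"
  by (simp add: cbox_Pair_eq)

lemma rectangle_lmeasurable:
  fixes a b c d :: real
  shows "{a..b} \<times> {c..d} \<in> lmeasurable"
  by (simp only: rectangle_eq_cbox lmeasurable_cbox)

lemma measure_rectangle:
  fixes a b w h :: real
  assumes "w \<ge> 0" "h \<ge> 0"
  shows "measure lebesgue ({a..a + w} \<times> {b..b + h}) = w * h"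
proof -
  have "measure lebesgue ({a..a + w} \<times> {b..b + h}) = measure lborel (cbox (a, b) (a + w, b + h))"
    unfolding rectangle_eq_cbox by (rule measure_completion) simp
  also have "\<dots> = measure lborel (cbox a (a + w)) * measure lborel (cbox b (b + h))"
    by (rule content_Pair)
  also have "\<dots> = w * h"
    using assms by simp
  finally show ?thesis .
qed

text \<open>Here \<open>min s w * min s h\<close> is the area of the part of the square that lies in the box. The longer
  side is always at least \<open>s\<close>. If the shorter one is too, the loss \<open>w * h - s\<^sup>2\<close> is of order \<open>\<epsilon>\<close>; only
  a shorter side below \<open>s\<close> lets the difference of the sides, of order \<open>sqrt \<epsilon> * s\<close>, enter, and half
  of that difference is the source of the coefficient \<open>1 / 4\<close>.\<close>
lemma box_minus_corner_square_area:
  fixes w h s \<epsilon> :: real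
  assumes "w \<ge> 0" "h \<ge> 0" "s > 0" "\<epsilon> \<ge> 0"
    and area: "s\<^sup>2 \<le> w * h"
    and perimeter: "4 * (w + h)\<^sup>2 \<le> (16 + \<epsilon>) * s\<^sup>2"
  shows "w * h - min s w * min s h \<le> (sqrt \<epsilon> / 4 + \<epsilon> / 16) * s\<^sup>2"
  using assms(1,2) area perimeter
proof (induction w h rule: linorder_wlog)
  case (sym h w)
  then show ?case
    by (simp add: mult.commute add.commute)
next
  case (le h w)
  have sum_sq: "(h + w)\<^sup>2 \<le> (4 + \<epsilon> / 4) * s\<^sup>2"
    using le by (simp add: algebra_simps)
  have "s\<^sup>2 \<le> w\<^sup>2"
    using le mult_right_mono[of h w w] by (simp add: power2_eq_square)
  then have sw: "s \<le> w"
    using assms(3) le by (simp add: power2_le_iff_abs_le)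
  show ?case
  proof (cases "s \<le> h")
    case True
    have "h * w \<le> (h + w)\<^sup>2 / 4"
      using zero_le_power2[of "h - w"] by (simp add: power2_eq_square algebra_simps)
    also have "\<dots> \<le> s\<^sup>2 + \<epsilon> / 16 * s\<^sup>2"
      using sum_sq by (simp add: algebra_simps)
    finally have "h * w - s\<^sup>2 \<le> \<epsilon> / 16 * s\<^sup>2"
      by simp
    also have "\<dots> \<le> (sqrt \<epsilon> / 4 + \<epsilon> / 16) * s\<^sup>2"
      using assms(4) by (intro mult_right_mono) auto
    finally show ?thesis
      using True sw by (simp add: power2_eq_square)
  next
    case False
    have "(h + w)\<^sup>2 \<le> ((2 + \<epsilon> / 16) * s)\<^sup>2"
    proof (rule order_trans[OF sum_sq])
      show "(4 + \<epsilon> / 4) * s\<^sup>2 \<le> ((2 + \<epsilon> / 16) * s)\<^sup>2"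
        unfolding power_mult_distrib
        by (intro mult_right_mono) (auto simp: power2_eq_square algebra_simps)
    qed
    then have sum: "h + w \<le> (2 + \<epsilon> / 16) * s"
      by (rule power2_le_imp_le) (use assms(3,4) in simp)
    have "(w - h)\<^sup>2 = (h + w)\<^sup>2 - 4 * (h * w)"
      by (simp add: power2_eq_square algebra_simps)
    also have "\<dots> \<le> \<epsilon> / 4 * s\<^sup>2"
      using sum_sq le by (simp add: algebra_simps)
    also have "\<dots> = (sqrt \<epsilon> / 2 * s)\<^sup>2"
      using assms(4) by (simp add: power_mult_distrib power_divide)
    finally have diff: "w - h \<le> sqrt \<epsilon> / 2 * s"
      by (rule power2_le_imp_le) (use assms(3,4) in simp)
    \<comment> \<open>Half the sum of the last two bounds, with \<open>\<epsilon> / 32\<close> relaxed to the \<open>\<epsilon> / 16\<close> of the other case.\<close>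
    have excess: "w - s \<le> (sqrt \<epsilon> / 4 + \<epsilon> / 16) * s"
    proof -
      have "0 \<le> \<epsilon> * s"
        using assms(3,4) by simp
      then show ?thesis
        using sum diff by (simp add: algebra_simps)
    qed
    have "h * w - h * s = (w - s) * h"
      by (simp add: algebra_simps)
    also have "\<dots> \<le> (w - s) * s"
      using False sw by (intro mult_left_mono) auto
    also have "\<dots> \<le> (sqrt \<epsilon> / 4 + \<epsilon> / 16) * s * s"
      using excess assms(3) by (intro mult_right_mono) auto
    finally show ?thesis
      using False sw by (simp add: power2_eq_square mult.assoc)
  qed
qed

lemma measure_minus_corner_square_le:
  assumes "A \<in> lmeasurable" "A \<subseteq> {a..a + w} \<times> {b..b + h}" "w \<ge> 0" "h \<ge> 0" "s \<ge> 0"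
  shows "measure lebesgue (A - {a..a + s} \<times> {b..b + s}) \<le> w * h - min s w * min s h"
proof -
  let ?R = "{a..a + w} \<times> {b..b + h}" and ?S = "{a..a + s} \<times> {b..b + s}"
  let ?I = "{a..a + min s w} \<times> {b..b + min s h}"
  have I: "?I \<subseteq> ?R" "?R - ?S = ?R - ?I"
    by auto
  have "measure lebesgue (A - ?S) \<le> measure lebesgue (?R - ?I)"
    using assms I(2)
    by (intro measure_mono_fmeasurable fmeasurable.Diff fmeasurableD sets.Diff
        rectangle_lmeasurable) auto
  also have "\<dots> = measure lebesgue ?R - measure lebesgue ?I"
    using I(1) by (intro measurable_measure_Diff rectangle_lmeasurable fmeasurableD)
  finally show ?thesis
    using assms by (simp add: measure_rectangle)
qed

lemma jordan_domain_compact: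
  assumes "jordan_domain A"
  shows "compact A"
  using assms by (auto simp: jordan_domain_def)

lemma jordan_domain_measure_pos:
  assumes "jordan_domain A"
  shows "measure lebesgue A > 0"
proof -
  obtain \<gamma> U where \<gamma>: "jordan_curve \<gamma>" and U: "U \<in> components (- path_image \<gamma>)" "A = closure U"
    using assms by (auto simp: jordan_domain_def)
  have "open (- path_image \<gamma>)"
    using \<gamma> by (simp add: jordan_curve_def simple_path_imp_path closed_path_image open_Compl)
  then have "open U" "U \<noteq> {}"
    using U(1) open_components in_components_nonempty by blast+
  then have "\<not> negligible A"
    using negligible_subset open_not_negligible U(2) closure_subset by metis
  moreover have "A \<in> lmeasurable"
    using jordan_domain_compact[OF assms] by (rule lmeasurable_compact)
  ultimately show ?thesis
    using negligible_iff_measure measure_nonneg by (metis less_eq_real_def)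
qed

section \<open>Stability of the square\<close>

theorem proposition1p2:
  shows "\<exists>\<epsilon>\<^sub>0>0. \<exists>C>0. \<forall>\<epsilon>\<in>{0..\<epsilon>\<^sub>0::real}. \<forall>(A :: (real \<times> real) set) (\<gamma> :: real \<Rightarrow> real \<times> real).
           jordan_domain A \<and> jordan_curve \<gamma> \<and> path_image \<gamma> = frontier A \<and> rectifiable \<gamma> \<and>
           (l1_length \<gamma>)\<^sup>2 \<le> (16 + \<epsilon>) * measure lebesgue A \<longrightarrow>
           (\<exists>S. axis_square S \<and> measure lebesgue S = measure lebesgue A \<and>
                measure lebesgue (S \<inter> A) \<ge> (1 - sqrt \<epsilon> / 4 - C * \<epsilon>) * measure lebesgue A \<and>
                measure lebesgue (sym_diff S A) / measure lebesgue A \<le> sqrt \<epsilon> / 2 + 2 * C * \<epsilon>)"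
proof -
  have "\<exists>S. axis_square S \<and> measure lebesgue S = measure lebesgue A \<and>
            measure lebesgue (S \<inter> A) \<ge> (1 - sqrt \<epsilon> / 4 - 1 / 16 * \<epsilon>) * measure lebesgue A \<and>
            measure lebesgue (sym_diff S A) / measure lebesgue A \<le> sqrt \<epsilon> / 2 + 2 * (1 / 16) * \<epsilon>"
    if "\<epsilon> \<ge> 0" and dom: "jordan_domain A" and \<gamma>: "jordan_curve \<gamma>" "path_image \<gamma> = frontier A"
        "rectifiable \<gamma>" and len: "(l1_length \<gamma>)\<^sup>2 \<le> (16 + \<epsilon>) * measure lebesgue A"
    for \<epsilon> A \<gamma>
  proof -
    let ?m = "measure lebesgue"
    have A: "A \<in> lmeasurable" and pos: "?m A > 0"
      using dom by (auto intro: lmeasurable_compact jordan_domain_compact jordan_domain_measure_pos)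
    then have "A \<noteq> {}"
      by auto
    then obtain a b w h where box: "w \<ge> 0" "h \<ge> 0" "A \<subseteq> {a..a + w} \<times> {b..b + h}"
        and perimeter: "2 * (w + h) \<le> l1_length \<gamma>"
      using bounding_box_perimeter_le[OF jordan_domain_compact[OF dom]] \<gamma>
      unfolding jordan_curve_def by metis
    define s where "s = sqrt (?m A)"
    have s: "s > 0" "s\<^sup>2 = ?m A"
      using pos by (simp_all add: s_def)
    have area: "s\<^sup>2 \<le> w * h"
      unfolding s(2) measure_rectangle[OF box(1,2), symmetric, of a b]
      using box(3) A by (intro measure_mono_fmeasurable rectangle_lmeasurable fmeasurableD)
    have "4 * (w + h)\<^sup>2 = (2 * (w + h))\<^sup>2"
      unfolding power_mult_distrib by simp
    also have "\<dots> \<le> (l1_length \<gamma>)\<^sup>2"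
      using perimeter box(1,2) by (intro power_mono) auto
    also have "\<dots> \<le> (16 + \<epsilon>) * s\<^sup>2"
      using len s(2) by simp
    finally have near: "4 * (w + h)\<^sup>2 \<le> (16 + \<epsilon>) * s\<^sup>2" .
    define S where "S = {a..a + s} \<times> {b..b + s}"
    have S: "S \<in> lmeasurable" "?m S = ?m A" "axis_square S"
      using s by (auto simp: S_def rectangle_lmeasurable measure_rectangle power2_eq_square
          axis_square_def)
    have lost: "?m (A - S) \<le> (sqrt \<epsilon> / 4 + \<epsilon> / 16) * ?m A"
      using order_trans[OF measure_minus_corner_square_le[OF A box(3,1,2)]
          box_minus_corner_square_area[OF box(1,2) s(1) that(1) area near]] s
      by (simp add: S_def)
    have split: "?m B = ?m (B \<inter> D) + ?m (B - D)" if "B \<in> lmeasurable" "D \<in> lmeasurable" for B D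
      using measure_Un2[of "B \<inter> D" lebesgue B] that
      by (simp add: fmeasurable.Int Un_absorb1 Diff_Int)
    have "?m A = ?m (A \<inter> S) + ?m (A - S)" "?m S = ?m (S \<inter> A) + ?m (S - A)"
      using A S(1) by (auto intro: split)
    moreover have "?m (sym_diff S A) = ?m (S - A) + ?m (A - S)"
      using measure_Un2[of "S - A" lebesgue "A - S"] A S(1)
      by (simp add: fmeasurable.Diff fmeasurableD Diff_triv Int_Diff Diff_Int_distrib2)
    ultimately have inter: "?m (S \<inter> A) = ?m A - ?m (A - S)"
        and sym: "?m (sym_diff S A) = 2 * ?m (A - S)"
      using S(2) by (simp_all add: Int_commute)
    have "?m (S \<inter> A) \<ge> (1 - sqrt \<epsilon> / 4 - 1 / 16 * \<epsilon>) * ?m A"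
      unfolding inter using lost by (simp add: algebra_simps)
    moreover have "?m (sym_diff S A) / ?m A \<le> sqrt \<epsilon> / 2 + 2 * (1 / 16) * \<epsilon>"
      unfolding sym using lost pos by (simp add: field_simps)
    ultimately show ?thesis
      using S(2,3) by blast
  qed
  then show ?thesis
    by (intro exI[of _ 1] conjI exI[of _ "1 / 16"]) auto
qed

end
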